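(* Let $G$ be a simple undirected graph on vertex set $[n]$, $n\ge 4$, with $m$ edges, and let $\mathbf{c}=(c_1,\ldots,c_s)$ be a tuple of positive integers with $c_1+\cdots+c_s=n$. Let $g$ be a uniformly random coloring of $[n]$ with profile $\mathbf{c}$ and, for $i\in[s]$, let $M_i$ be the number of edges of $G$ both of whose endpoints have color $i$ under $g$. Then for all $i,j\in[s]$ with $i\neq j$, $$\mathrm{cov}(M_i,M_j)=c_i^{\underline{2}}\,c_j^{\underline{2}}\left[\frac{2}{n^{\underline{4}}}\left\{\binom{m}{2}-\pi_3(G)\right\}-\left(\frac{m}{n^{\underline{2}}}\right)^2\right].$$ That is, $\mathrm{cov}(M_i,M_j)=\gamma(G)\,c_i^{\underline{2}}\,c_j^{\underline{2}}$, where $$\gamma(G)=\frac{2}{n^{\underline{4}}}\left\{\binom{m}{2}-\pi_3(G)\right\}-\left(\frac{m}{n^{\underline{2}}}\right)^2$$ depends only on $G$, through its density and the distribution of its degrees.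
   Context: For a positive integer $k$, $[k]=\{1,\ldots,k\}$. For a positive integer $a$ and a nonnegative integer $q$, $a^{\underline{q}}=a(a-1)\cdots(a-q+1)$ is the $q$-th falling factorial, with $a^{\underline{0}}=1$. A coloring of $[n]$ with profile $\mathbf{c}=(c_1,\ldots,c_s)$ is a map $g:[n]\to[s]$ with $|g^{-1}(i)|=c_i$ for every $i\in[s]$. The random coloring model is the set $\Phi_{\mathbf{c}}$ of all colorings with profile $\mathbf{c}$ equipped with the uniform probability measure, each coloring having probability $c_1!\cdots c_s!/n!$; expectations and covariances are taken in this model, with $G$ fixed. $\pi_3(G)$ denotes the number of (not necessarily induced) copies in $G$ of the path $P_3$ on three vertices, i.e. the number of unordered pairs of distinct edges of $G$ sharing exactly one vertex. *)

theory Defs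
  imports "HOL-Probability.Probability"
begin

definition ffactorial :: "nat \<Rightarrow> nat \<Rightarrow> real" where
  "ffactorial a q = (\<Prod>k<q. real a - real k)"

text \<open>A simple undirected graph on the vertex set \<open>V\<close> is given by its set of edges,
  which are two-element subsets of \<open>V\<close>.\<close>

definition simple_graph :: "'v set \<Rightarrow> 'v set set \<Rightarrow> bool" where
  "simple_graph V E \<longleftrightarrow> (\<forall>e\<in>E. e \<subseteq> V \<and> card e = 2)"

definition vdegree :: "'v set set \<Rightarrow> 'v \<Rightarrow> nat" where
  "vdegree E v = card {e \<in> E. v \<in> e}"

definition graph_density :: "'v set \<Rightarrow> 'v set set \<Rightarrow> real" where
  "graph_density V E = real (card E) / real (card V choose 2)"

definition degree_distribution :: "'v set \<Rightarrow> 'v set set \<Rightarrow> nat \<Rightarrow> nat" where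
  "degree_distribution V E k = card {v \<in> V. vdegree E v = k}"

definition pi3 :: "'v set set \<Rightarrow> nat" where
  "pi3 E = card {{e, f} | e f. e \<in> E \<and> f \<in> E \<and> e \<noteq> f \<and> card (e \<inter> f) = 1}"

definition gamma_coeff :: "'v set \<Rightarrow> 'v set set \<Rightarrow> real" where
  "gamma_coeff V E =
     2 / ffactorial (card V) 4 * (real (card E choose 2) - real (pi3 E))
     - (real (card E) / ffactorial (card V) 2)\<^sup>2"

text \<open>Colorings are extensional functions, so that each map from \<open>{1..n}\<close> to \<open>{1..s}\<close>
  is counted once. The tuple \<open>(c\<^sub>1, \<dots>, c\<^sub>s)\<close> is represented by the values of \<open>c\<close> on \<open>{1..s}\<close>;
  other values of \<open>c\<close> are irrelevant.\<close>

definition colorings :: "nat \<Rightarrow> nat \<Rightarrow> (nat \<Rightarrow> nat) \<Rightarrow> (nat \<Rightarrow> nat) set" where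
  "colorings n s c =
     {g \<in> {1..n} \<rightarrow>\<^sub>E {1..s}. \<forall>i\<in>{1..s}. card {v \<in> {1..n}. g v = i} = c i}"

text \<open>The set of colorings is finite, and it is nonempty when \<open>c\<^sub>1 + \<dots> + c\<^sub>s = n\<close>;
  only then is \<^const>\<open>pmf_of_set\<close> the uniform distribution on it.\<close>

definition random_coloring :: "nat \<Rightarrow> nat \<Rightarrow> (nat \<Rightarrow> nat) \<Rightarrow> (nat \<Rightarrow> nat) pmf" where
  "random_coloring n s c = pmf_of_set (colorings n s c)"

definition mono_edges :: "'v set set \<Rightarrow> nat \<Rightarrow> ('v \<Rightarrow> nat) \<Rightarrow> real" where
  "mono_edges E i g = real (card {e \<in> E. \<forall>v\<in>e. g v = i})"

definition covariance :: "'a measure \<Rightarrow> ('a \<Rightarrow> real) \<Rightarrow> ('a \<Rightarrow> real) \<Rightarrow> real" where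
  "covariance M X Y =
     (LINT w|M. (X w - (LINT z|M. X z)) * (Y w - (LINT z|M. Y z)))"

end

(* The group of permutations of the vertex set acts on the colorings, so the number of colorings
   with A in color class i and B in color class j depends only on the sizes of the disjoint sets
   A and B. Averaging over all such pairs (A, B) gives the probability
   (c_i choose a) (c_j choose b) / ((n choose a) (n-a choose b)). For i \<noteq> j, only the ordered
   pairs of disjoint edges contribute to E(M_i M_j), and there are 2 ((m choose 2) - pi_3) of them.
   Finally pi_3 is the sum of (d choose 2) over the vertex degrees d. *)

theory Submission
  imports Defs
begin

section \<open>Counting colorings\<close>

lemma finite_colorings: "finite (colorings n s c)"
  unfolding colorings_def
  by (rule finite_subset[of _ "{1..n} \<rightarrow>\<^sub>E {1..s}"]) (auto intro: finite_PiE)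

text \<open>Guarantees that \<open>pmf_of_set\<close> really is the uniform distribution on the
  colorings and that dividing by their number is legitimate.\<close>

lemma colorings_nonempty:
  assumes "(\<Sum>i=1..s. c i) = n"
  shows "colorings n s c \<noteq> {}"
proof -
  \<comment> \<open>\<open>S\<close> consists of \<open>c i\<close> slots for each color
    \<open>i\<close>, hence \<open>n\<close> slots in all. Any bijection from the vertices to the
    slots gives a coloring by reading off the first coordinate.\<close>
  define S where "S = (SIGMA i:{1..s}. {..<c i})"
  have "card S = card {1..n}"
    unfolding S_def using assms by (simp add: card_SigmaI)
  moreover have "finite S" by (simp add: S_def)
  ultimately obtain h where h: "bij_betw h {1..n} S"
    using finite_same_card_bij[of "{1..n}" S] by auto
  define g where "g = (\<lambda>v\<in>{1..n}. fst (h v))"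
  have hS: "h v \<in> S" if "v \<in> {1..n}" for v
    using h that by (auto simp: bij_betw_def)
  have "card {v \<in> {1..n}. g v = i} = c i" if i: "i \<in> {1..s}" for i
  proof -
    have "h ` {v \<in> {1..n}. g v = i} = {i} \<times> {..<c i}"
    proof (intro equalityI subsetI)
      fix x assume "x \<in> h ` {v \<in> {1..n}. g v = i}"
      then obtain v where v: "v \<in> {1..n}" "g v = i" "x = h v" by auto
      then show "x \<in> {i} \<times> {..<c i}"
        using hS[OF v(1)] by (auto simp: g_def S_def)
    next
      fix x assume x: "x \<in> {i} \<times> {..<c i}"
      then have "x \<in> S" using i by (auto simp: S_def)
      then obtain v where "v \<in> {1..n}" "x = h v"
        using h by (auto simp: bij_betw_def)
      then show "x \<in> h ` {v \<in> {1..n}. g v = i}"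
        using x by (auto simp: g_def)
    qed
    moreover have "inj_on h {v \<in> {1..n}. g v = i}"
      by (rule inj_on_subset[OF bij_betw_imp_inj_on[OF h]]) auto
    ultimately have "card ({i} \<times> {..<c i}) = card {v \<in> {1..n}. g v = i}"
      by (metis card_image)
    then show ?thesis by simp
  qed
  moreover have "g \<in> {1..n} \<rightarrow>\<^sub>E {1..s}"
  proof -
    have "fst (h v) \<in> {1..s}" if "v \<in> {1..n}" for v
      using hS[OF that] by (auto simp: S_def)
    then show ?thesis by (auto simp: g_def)
  qed
  ultimately have "g \<in> colorings n s c" by (simp add: colorings_def)
  then show ?thesis by blast
qed

section \<open>Action of vertex permutations on colorings\<close>

lemma colorings_compose:
  assumes p: "bij_betw p {1..n} {1..n}" and g: "g \<in> colorings n s c"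
  shows "(\<lambda>v\<in>{1..n}. g (p v)) \<in> colorings n s c"
proof -
  have p_in: "p v \<in> {1..n}" if "v \<in> {1..n}" for v
    using bij_betwE[OF p] that by blast
  have "card {v \<in> {1..n}. g (p v) = i} = card {v \<in> {1..n}. g v = i}" for i
  proof -
    \<comment> \<open>\<open>p\<close> carries each color class of the composed coloring bijectively
      onto the class of \<open>g\<close>, so the profile is preserved.\<close>
    have "{v \<in> {1..n}. g v = i} \<subseteq> p ` {v \<in> {1..n}. g (p v) = i}"
    proof
      fix w assume w: "w \<in> {v \<in> {1..n}. g v = i}"
      then have "w \<in> p ` {1..n}" using bij_betw_imp_surj_on[OF p] by simp
      then obtain v where "v \<in> {1..n}" "w = p v" by blast
      with w show "w \<in> p ` {v \<in> {1..n}. g (p v) = i}" by simp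
    qed
    moreover have "p ` {v \<in> {1..n}. g (p v) = i} \<subseteq> {v \<in> {1..n}. g v = i}"
      using p_in by blast
    ultimately have "p ` {v \<in> {1..n}. g (p v) = i} = {v \<in> {1..n}. g v = i}" by blast
    moreover have "inj_on p {v \<in> {1..n}. g (p v) = i}"
      by (rule inj_on_subset[OF bij_betw_imp_inj_on[OF p]]) blast
    ultimately show ?thesis by (auto dest: card_image)
  qed
  moreover have "{v \<in> {1..n}. (\<lambda>v\<in>{1..n}. g (p v)) v = i} = {v \<in> {1..n}. g (p v) = i}" for i
    by auto
  moreover have "g v \<in> {1..s}" if "v \<in> {1..n}" for v
    using g that by (auto simp: colorings_def)
  then have "(\<lambda>v\<in>{1..n}. g (p v)) \<in> {1..n} \<rightarrow>\<^sub>E {1..s}"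
    using p_in by simp
  ultimately show ?thesis
    using g by (simp add: colorings_def)
qed

text \<open>Two prescribed sets serve both moments: \<open>B = {}\<close> handles a single edge, and
  two disjoint edges handle the product.\<close>

definition colorings_with ::
    "nat \<Rightarrow> nat \<Rightarrow> (nat \<Rightarrow> nat) \<Rightarrow> nat \<Rightarrow> nat \<Rightarrow> nat set \<Rightarrow> nat set \<Rightarrow> (nat \<Rightarrow> nat) set" where
  "colorings_with n s c i j A B =
     {g \<in> colorings n s c. (\<forall>v\<in>A. g v = i) \<and> (\<forall>v\<in>B. g v = j)}"

text \<open>Precomposition with \<open>p\<close> pulls conditions on \<open>p\<close>
  A\<open>and\<close>p \<open>B\<close> back to \<open>A\<close> and \<open>B\<close>, and it is
  injective because \<open>p\<close> is onto. An inequality suffices, since the reverse one comes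
  from exchanging the two pairs.\<close>

lemma card_colorings_with_le:
  assumes p: "bij_betw p {1..n} {1..n}" and sub: "A \<subseteq> {1..n}" "B \<subseteq> {1..n}"
  shows "card (colorings_with n s c i j (p ` A) (p ` B)) \<le> card (colorings_with n s c i j A B)"
proof (rule card_inj_on_le)
  let ?F = "\<lambda>g. \<lambda>v\<in>{1..n}. g (p v)"
  show "finite (colorings_with n s c i j A B)"
    using finite_colorings by (auto simp: colorings_with_def)
  show "?F ` colorings_with n s c i j (p ` A) (p ` B) \<subseteq> colorings_with n s c i j A B"
    using colorings_compose[OF p] sub by (auto simp: colorings_with_def)
  show "inj_on ?F (colorings_with n s c i j (p ` A) (p ` B))"
  proof (rule inj_onI)
    fix g h
    assume gh: "g \<in> colorings_with n s c i j (p ` A) (p ` B)"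
      "h \<in> colorings_with n s c i j (p ` A) (p ` B)" and eq: "?F g = ?F h"
    show "g = h"
    proof (rule PiE_ext)
      show "g \<in> {1..n} \<rightarrow>\<^sub>E {1..s}" "h \<in> {1..n} \<rightarrow>\<^sub>E {1..s}"
        using gh by (auto simp: colorings_with_def colorings_def)
      fix w assume "w \<in> {1..n}"
      then have "w \<in> p ` {1..n}" using p by (simp add: bij_betw_def)
      then obtain v where "v \<in> {1..n}" "w = p v" by blast
      then show "g w = h w" using fun_cong[OF eq, of v] by simp
    qed
  qed
qed

text \<open>The complements of the two unions also have equal size, so bijections between the three
  corresponding blocks glue to a permutation of \<open>V\<close>.\<close>

lemma bij_betw_disjoint_pairs:
  assumes "finite V" "A \<subseteq> V" "B \<subseteq> V" "A \<inter> B = {}"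
    and "A' \<subseteq> V" "B' \<subseteq> V" "A' \<inter> B' = {}"
    and "card A = card A'" "card B = card B'"
  obtains p where "bij_betw p V V" "p ` A = A'" "p ` B = B'"
proof -
  have fin: "finite A" "finite B" "finite A'" "finite B'"
    using assms by (auto intro: finite_subset)
  obtain f where f: "bij_betw f A A'"
    using finite_same_card_bij assms(8) fin by blast
  obtain g where g: "bij_betw g B B'"
    using finite_same_card_bij assms(9) fin by blast
  have "card (V - (A \<union> B)) = card (V - (A' \<union> B'))"
    using assms fin by (simp add: card_Diff_subset card_Un_disjoint)
  then obtain h where h: "bij_betw h (V - (A \<union> B)) (V - (A' \<union> B'))"
    using finite_same_card_bij assms(1) by (meson finite_Diff)
  define p where "p = (\<lambda>v. if v \<in> A then f v else if v \<in> B then g v else h v)"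
  have pA: "bij_betw p A A'"
    using f by (rule bij_betw_cong[THEN iffD1, rotated]) (simp add: p_def)
  have pB: "bij_betw p B B'"
    using g by (rule bij_betw_cong[THEN iffD1, rotated]) (use assms(4) in \<open>auto simp: p_def\<close>)
  have pC: "bij_betw p (V - (A \<union> B)) (V - (A' \<union> B'))"
    using h by (rule bij_betw_cong[THEN iffD1, rotated]) (auto simp: p_def)
  have "bij_betw p (A \<union> B \<union> (V - (A \<union> B))) (A' \<union> B' \<union> (V - (A' \<union> B')))"
    using pA pB pC assms(7) by (intro bij_betw_combine) auto
  moreover have "A \<union> B \<union> (V - (A \<union> B)) = V" "A' \<union> B' \<union> (V - (A' \<union> B')) = V"
    using assms by auto
  ultimately have "bij_betw p V V" by simp
  then show ?thesis
    using that pA pB by (auto simp: bij_betw_def)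
qed

text \<open>Permutations act transitively on disjoint pairs of fixed sizes; the two inequalities are
  one statement applied in both directions.\<close>

lemma card_colorings_with_cong:
  assumes "A \<subseteq> {1..n}" "B \<subseteq> {1..n}" "A \<inter> B = {}"
    and "A' \<subseteq> {1..n}" "B' \<subseteq> {1..n}" "A' \<inter> B' = {}"
    and "card A = card A'" "card B = card B'"
  shows "card (colorings_with n s c i j A B) = card (colorings_with n s c i j A' B')"
proof -
  have le: "card (colorings_with n s c i j A' B') \<le> card (colorings_with n s c i j A B)"
    if AB: "A \<subseteq> {1..n}" "B \<subseteq> {1..n}" "A \<inter> B = {}"
      "A' \<subseteq> {1..n}" "B' \<subseteq> {1..n}" "A' \<inter> B' = {}"
      "card A = card A'" "card B = card B'" for A B A' B'
  proof -
    obtain p where p: "bij_betw p {1..n} {1..n}" and eq: "p ` A = A'" "p ` B = B'"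
      by (rule bij_betw_disjoint_pairs[OF finite_atLeastAtMost AB])
    from card_colorings_with_le[OF p AB(1,2)] show ?thesis by (simp only: eq)
  qed
  show ?thesis
    by (rule antisym; rule le) (use assms in auto)
qed

section \<open>Double counting of colorings against disjoint pairs of vertex sets\<close>

definition disjoint_pairs :: "'a set \<Rightarrow> nat \<Rightarrow> nat \<Rightarrow> ('a set \<times> 'a set) set" where
  "disjoint_pairs V a b =
     (SIGMA A:{A. A \<subseteq> V \<and> card A = a}. {B. B \<subseteq> V - A \<and> card B = b})"

lemma finite_disjoint_pairs: "finite V \<Longrightarrow> finite (disjoint_pairs V a b)"
  unfolding disjoint_pairs_def by (rule finite_SigmaI) auto

text \<open>Whatever \<open>A\<close> is chosen first, \<open>card V - a\<close> vertices remain for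
  \<open>B\<close>, so all fibers of the Sigma set have the same size.\<close>

lemma card_disjoint_pairs:
  assumes "finite V"
  shows "card (disjoint_pairs V a b) = (card V choose a) * ((card V - a) choose b)"
proof -
  have "card {B. B \<subseteq> V - A \<and> card B = b} = (card V - a) choose b"
    if "A \<in> {A. A \<subseteq> V \<and> card A = a}" for A
    using that assms by (subst n_subsets) (auto simp: card_Diff_subset finite_subset)
  then show ?thesis
    unfolding disjoint_pairs_def using assms
    by (subst card_SigmaI) (auto simp: n_subsets)
qed

text \<open>Counts in two ways the incidences between colorings and pairs of sets that they color
  \<open>i\<close> and \<open>j\<close>. By symmetry each pair contributes equally. The probability
  formula is kept free of division.\<close>

lemma card_colorings_with:
  assumes ij: "i \<in> {1..s}" "j \<in> {1..s}" "i \<noteq> j"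
    and AB: "A \<subseteq> {1..n}" "B \<subseteq> {1..n}" "A \<inter> B = {}"
  shows "card (colorings_with n s c i j A B) * ((n choose card A) * ((n - card A) choose card B)) =
    card (colorings n s c) * ((c i choose card A) * (c j choose card B))"
proof -
  define P where "P = disjoint_pairs {1..n} (card A) (card B)"
  define R where "R = (\<lambda>(g::nat \<Rightarrow> nat) (A', B'). (\<forall>v\<in>A'. g v = i) \<and> (\<forall>v\<in>B'. g v = j))"
  have finP: "finite P" by (simp add: P_def finite_disjoint_pairs)
  have mono: "card {x \<in> P. R g x} = (c i choose card A) * (c j choose card B)"
    if g: "g \<in> colorings n s c" for g
  proof -
    \<comment> \<open>Classes of distinct colors are disjoint, so the two subsets can be chosen
      independently inside their classes.\<close>
    have "{x \<in> P. R g x} = {X. X \<subseteq> {v \<in> {1..n}. g v = i} \<and> card X = card A} \<times>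
        {X. X \<subseteq> {v \<in> {1..n}. g v = j} \<and> card X = card B}"
      using ij(3) by (fastforce simp: P_def R_def disjoint_pairs_def)
    then show ?thesis
      using g ij by (simp add: card_cartesian_product n_subsets colorings_def)
  qed
  have sym: "card {g \<in> colorings n s c. R g x} = card (colorings_with n s c i j A B)"
    if x: "x \<in> P" for x
  proof -
    obtain A' B' where x': "x = (A', B')" by (cases x)
    have "{g \<in> colorings n s c. R g x} = colorings_with n s c i j A' B'"
      by (auto simp: colorings_with_def R_def x')
    moreover have "card (colorings_with n s c i j A' B') = card (colorings_with n s c i j A B)"
      using x AB by (intro card_colorings_with_cong) (auto simp: P_def disjoint_pairs_def x')
    ultimately show ?thesis by simp
  qed
  have "(\<Sum>g\<in>colorings n s c. card {x \<in> P. R g x}) = (\<Sum>x\<in>P. card {g \<in> colorings n s c. R g x})"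
    using finP finite_colorings by (intro sum_multicount_gen) auto
  then have "card (colorings n s c) * ((c i choose card A) * (c j choose card B)) =
      card P * card (colorings_with n s c i j A B)"
    using mono sym by simp
  then show ?thesis
    by (simp add: P_def card_disjoint_pairs mult.commute)
qed

section \<open>Pairs of edges\<close>

lemma simple_graph_finite:
  assumes "finite V" "simple_graph V E"
  shows "finite E"
  using assms by (auto simp: simple_graph_def intro: finite_subset[of E "Pow V"])

text \<open>The map from ordered to unordered pairs has fibers of size exactly two: symmetry
  supplies the swapped pair, and irreflexivity makes it different.\<close>

lemma card_symmetric_pairs:
  assumes fin: "finite E" and sym: "\<And>e f. R e f \<Longrightarrow> R f e" and irrefl: "\<And>e. \<not> R e e"
  shows "card {(e, f). e \<in> E \<and> f \<in> E \<and> R e f} =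
    2 * card {{e, f} | e f. e \<in> E \<and> f \<in> E \<and> R e f}"
proof -
  let ?S = "{(e, f). e \<in> E \<and> f \<in> E \<and> R e f}"
  let ?U = "{{e, f} | e f. e \<in> E \<and> f \<in> E \<and> R e f}"
  let ?h = "\<lambda>(e, f). {e, f}"
  have finS: "finite ?S"
    by (rule finite_subset[of _ "E \<times> E"]) (use fin in auto)
  have U: "?U = ?h ` ?S" by force
  have fiber: "card {x \<in> ?S. ?h x = y} = 2" if y: "y \<in> ?U" for y
  proof -
    obtain e f where ef: "e \<in> E" "f \<in> E" "R e f" "y = {e, f}" using y by auto
    then have "{x \<in> ?S. ?h x = y} = {(e, f), (f, e)}"
      using sym by (auto simp: doubleton_eq_iff)
    moreover have "e \<noteq> f" using ef irrefl by auto
    ultimately show ?thesis by simp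
  qed
  have "card ?S = (\<Sum>y\<in>?U. \<Sum>x\<in>{x \<in> ?S. ?h x = y}. 1)"
    unfolding U by (subst sum.image_gen[OF finS, of _ ?h, symmetric]) simp
  also have "\<dots> = (\<Sum>y\<in>?U. 2)"
    using fiber by (intro sum.cong) auto
  finally show ?thesis by simp
qed

lemma edges_inter_cases:
  assumes "card e = 2" "card f = 2" "e \<noteq> f"
  shows "e \<inter> f = {} \<or> card (e \<inter> f) = 1"
  using assms by (auto simp: card_2_iff doubleton_eq_iff card_1_singleton_iff)

lemma real_choose_two: "real (k choose 2) = real k * (real k - 1) / 2"
  by (induction k) (simp_all add: numeral_2_eq_2 field_simps)

text \<open>Ordered pairs of edges are disjoint, meet in one vertex, or coincide. With
  \<open>m\<close> edges and \<open>D\<close> disjoint ordered pairs this reads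
  \<open>m * m = D + 2 * pi3 E + m\<close>.\<close>

lemma card_disjoint_edge_pairs:
  assumes "finite V" and G: "simple_graph V E"
  shows "real (card {(e, f). e \<in> E \<and> f \<in> E \<and> e \<inter> f = {}}) =
    2 * (real (card E choose 2) - real (pi3 E))"
proof -
  have fin: "finite E" using assms by (rule simple_graph_finite)
  let ?D = "{(e, f). e \<in> E \<and> f \<in> E \<and> e \<inter> f = {}}"
  let ?S = "{(e, f). e \<in> E \<and> f \<in> E \<and> (e \<noteq> f \<and> card (e \<inter> f) = 1)}"
  let ?I = "(\<lambda>e. (e, e)) ` E"
  have E2: "card e = 2" if "e \<in> E" for e using G that by (auto simp: simple_graph_def)
  have S: "card ?S = 2 * pi3 E"
    unfolding pi3_def by (rule card_symmetric_pairs) (auto simp: fin Int_commute)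
  have I: "card ?I = card E" by (simp add: card_image inj_on_def)
  have fins: "finite ?D" "finite ?S" "finite ?I"
    using fin by (auto intro: finite_subset[of _ "E \<times> E"])
  have "E \<times> E = ?D \<union> ?S \<union> ?I"
    using edges_inter_cases E2 by (auto simp: image_iff)
  then have "card E * card E = card (?D \<union> ?S \<union> ?I)"
    by (metis card_cartesian_product)
  also have "\<dots> = card (?D \<union> ?S) + card ?I"
    using fins E2 by (intro card_Un_disjoint) force+
  also have "card (?D \<union> ?S) = card ?D + card ?S"
    using fins by (intro card_Un_disjoint) auto
  finally have "card E * card E = card ?D + 2 * pi3 E + card E"
    using S I by simp
  \<comment> \<open>Only after passing to the reals are terms subtracted, which avoids truncated
    subtraction.\<close>
  from arg_cong[OF this, of real]
  have "real (card E) * real (card E) = real (card ?D) + 2 * real (pi3 E) + real (card E)"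
    by simp
  moreover have "real (card E choose 2) = real (card E) * (real (card E) - 1) / 2"
    by (rule real_choose_two)
  ultimately show ?thesis by (simp add: algebra_simps)
qed

text \<open>Each path on three vertices is classified by its middle vertex \<open>v\<close>, where
  it is a choice of two edges among those containing \<open>v\<close>.\<close>

lemma pi3_eq_sum_degrees:
  assumes "finite V" and G: "simple_graph V E"
  shows "pi3 E = (\<Sum>v\<in>V. vdegree E v choose 2)"
proof -
  have fin: "finite E" using assms by (rule simple_graph_finite)
  have E2: "card e = 2" "e \<subseteq> V" if "e \<in> E" for e using G that by (auto simp: simple_graph_def)
  let ?F = "\<lambda>v. {P. P \<subseteq> {e \<in> E. v \<in> e} \<and> card P = 2}"
  have "{{e, f} | e f. e \<in> E \<and> f \<in> E \<and> e \<noteq> f \<and> card (e \<inter> f) = 1} = (\<Union>v\<in>V. ?F v)"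
    (is "?L = ?R")
  proof (intro equalityI subsetI)
    fix P assume "P \<in> ?L"
    then obtain e f where ef: "P = {e, f}" "e \<in> E" "f \<in> E" "e \<noteq> f" "card (e \<inter> f) = 1" by auto
    then obtain v where "v \<in> e \<inter> f" by (metis card_1_singletonE insertI1)
    then show "P \<in> ?R" using ef E2 by (intro UN_I[of v]) auto
  next
    fix P assume "P \<in> ?R"
    then obtain v where v: "P \<subseteq> {e \<in> E. v \<in> e}" "card P = 2" by auto
    then obtain e f where ef: "P = {e, f}" "e \<noteq> f" by (auto simp: card_2_iff)
    then have "e \<in> E" "f \<in> E" "v \<in> e \<inter> f" using v by auto
    moreover from this have "card (e \<inter> f) = 1" using edges_inter_cases[of e f] E2 ef by blast
    ultimately show "P \<in> ?L" using ef by blast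
  qed
  then have "pi3 E = card (\<Union>v\<in>V. ?F v)" by (simp add: pi3_def)
  also have "\<dots> = (\<Sum>v\<in>V. card (?F v))"
  proof (rule card_UN_disjoint)
    \<comment> \<open>The middle vertex is unique, because distinct edges cannot share two
      vertices.\<close>
    show "\<forall>v\<in>V. \<forall>w\<in>V. v \<noteq> w \<longrightarrow> ?F v \<inter> ?F w = {}"
    proof (intro ballI impI equals0I)
      fix v w P assume vw: "v \<noteq> w" and P: "P \<in> ?F v \<inter> ?F w"
      then obtain e f where ef: "P = {e, f}" "e \<noteq> f" by (auto simp: card_2_iff)
      then have m: "e \<in> E" "f \<in> E" "{v, w} \<subseteq> e \<inter> f" using P by auto
      then have "card (e \<inter> f) = 1" using edges_inter_cases[of e f] E2 ef by blast
      then obtain x where "e \<inter> f = {x}" by (rule card_1_singletonE)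
      then have "{v, w} \<subseteq> {x}" using m by simp
      with vw show False by simp
    qed
  qed (use assms fin in auto)
  also have "\<dots> = (\<Sum>v\<in>V. vdegree E v choose 2)"
    using fin by (simp add: n_subsets vdegree_def)
  finally show ?thesis .
qed

text \<open>Equal degree distributions mean equal multisets of degrees, and the sum depends only on
  that multiset.\<close>

lemma sum_degrees_cong:
  assumes fin: "finite V" and eq: "degree_distribution V E' = degree_distribution V E"
  shows "(\<Sum>v\<in>V. (h (vdegree E' v) :: nat)) = (\<Sum>v\<in>V. h (vdegree E v))"
proof -
  have "image_mset (vdegree E') (mset_set V) = image_mset (vdegree E) (mset_set V)"
  proof (rule multiset_eqI)
    fix k
    have "count (image_mset (vdegree E) (mset_set V)) k = degree_distribution V E k" for E
    proof -
      have "count (image_mset (vdegree E) (mset_set V)) k = card {v \<in> V. k = vdegree E v}"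
        using fin by (simp add: count_image_mset')
      also have "{v \<in> V. k = vdegree E v} = {v \<in> V. vdegree E v = k}" by blast
      finally show ?thesis by (simp add: degree_distribution_def)
    qed
    then show "count (image_mset (vdegree E') (mset_set V)) k =
        count (image_mset (vdegree E) (mset_set V)) k" by (simp add: eq)
  qed
  then have "\<Sum>\<^sub># (image_mset h (image_mset (vdegree E') (mset_set V))) =
      \<Sum>\<^sub># (image_mset h (image_mset (vdegree E) (mset_set V)))" by simp
  then show ?thesis by (simp add: sum_unfold_sum_mset multiset.map_comp comp_def)
qed

text \<open>With \<open>V\<close> fixed, the density determines the number of edges and the degree
  distribution determines \<open>pi3\<close>; \<open>gamma_coeff\<close> is built from these two
  numbers.\<close>

lemma gamma_coeff_cong:
  assumes fin: "finite V" and V: "card V \<ge> 2"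
    and G: "simple_graph V E" "simple_graph V E'"
    and dens: "graph_density V E' = graph_density V E"
    and deg: "degree_distribution V E' = degree_distribution V E"
  shows "gamma_coeff V E' = gamma_coeff V E"
proof -
  have "card V choose 2 > 0" using V by simp
  then have "card E' = card E" using dens by (simp add: graph_density_def)
  moreover have "pi3 E' = pi3 E"
    using sum_degrees_cong[OF fin deg, of "\<lambda>d. d choose 2"] pi3_eq_sum_degrees[OF fin] G by simp
  ultimately show ?thesis by (simp add: gamma_coeff_def)
qed

section \<open>The covariance\<close>

text \<open>The usual expansion of the covariance as the mean of the product minus the product of
  the means, written with finite sums.\<close>

lemma covariance_pmf_of_set:
  fixes X Y :: "'a \<Rightarrow> real"
  assumes "finite S" "S \<noteq> {}"
  shows "covariance (pmf_of_set S) X Y =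
    (\<Sum>x\<in>S. X x * Y x) / card S - ((\<Sum>x\<in>S. X x) / card S) * ((\<Sum>x\<in>S. Y x) / card S)"
proof -
  define a b where "a = (\<Sum>x\<in>S. X x) / card S" and "b = (\<Sum>x\<in>S. Y x) / card S"
  have N: "real (card S) \<noteq> 0" using assms by auto
  have ab: "(\<Sum>x\<in>S. X x) = a * card S" "(\<Sum>x\<in>S. Y x) = b * card S"
    using N by (simp_all add: a_def b_def)
  have "(\<Sum>x\<in>S. (X x - a) * (Y x - b)) = (\<Sum>x\<in>S. X x * Y x - a * Y x - b * X x + a * b)"
    by (intro sum.cong) (auto simp: algebra_simps)
  also have "\<dots> = (\<Sum>x\<in>S. X x * Y x) - a * b * card S"
    by (simp add: sum.distrib sum_subtractf ab flip: sum_distrib_left)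
  finally have "(\<Sum>x\<in>S. (X x - a) * (Y x - b)) / card S = (\<Sum>x\<in>S. X x * Y x) / card S - a * b"
    using N by (simp add: diff_divide_distrib)
  then show ?thesis
    using assms by (simp add: covariance_def integral_pmf_of_set a_def b_def)
qed

section \<open>First and mixed moments of the monochromatic edge counts\<close>

lemma ffactorial_2: "ffactorial a 2 = 2 * real (a choose 2)"
  by (simp add: ffactorial_def real_choose_two lessThan_nat_numeral lessThan_Suc)

lemma ffactorial_4:
  assumes "n \<ge> 2"
  shows "ffactorial n 4 = 4 * real (n choose 2) * real ((n - 2) choose 2)"
  using assms
  by (simp add: ffactorial_def real_choose_two lessThan_nat_numeral lessThan_Suc of_nat_diff)

text \<open>Linearity of expectation: by the case \<open>B = {}\<close> of
  \<open>card_colorings_with\<close>, every edge has the same chance of being monochromatic in color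
  \<open>i\<close>.\<close>

lemma sum_mono_edges:
  assumes n: "n \<ge> 2" and G: "simple_graph {1..n} E"
    and ij: "i \<in> {1..s}" "j \<in> {1..s}" "i \<noteq> j"
  shows "(\<Sum>g\<in>colorings n s c. mono_edges E i g) =
    card (colorings n s c) * (ffactorial (c i) 2 * card E / ffactorial n 2)"
proof -
  have finE: "finite E" using simple_graph_finite[OF _ G] by simp
  have N: "real (card (colorings_with n s c i j e {})) =
      card (colorings n s c) * ffactorial (c i) 2 / ffactorial n 2" if e: "e \<in> E" for e
  proof -
    have "card (colorings_with n s c i j e {}) * (n choose 2) =
        card (colorings n s c) * (c i choose 2)"
      using card_colorings_with[OF ij, of e n "{}" c] e G by (auto simp: simple_graph_def)
    then have "real (card (colorings_with n s c i j e {})) * real (n choose 2) =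
        real (card (colorings n s c)) * real (c i choose 2)" by (metis of_nat_mult)
    moreover have "real (n choose 2) \<noteq> 0" using n by simp
    ultimately show ?thesis by (simp add: ffactorial_2 field_simps)
  qed
  have "(\<Sum>g\<in>colorings n s c. card {e \<in> E. \<forall>v\<in>e. g v = i}) =
      (\<Sum>e\<in>E. card (colorings_with n s c i j e {}))"
    using finE finite_colorings by (intro sum_multicount_gen) (auto simp: colorings_with_def)
  then have "(\<Sum>g\<in>colorings n s c. mono_edges E i g) =
      (\<Sum>e\<in>E. real (card (colorings_with n s c i j e {})))"
    by (simp add: mono_edges_def flip: of_nat_sum)
  then show ?thesis using N by simp
qed

text \<open>The product counts ordered pairs of an edge colored \<open>i\<close> and an edge colored
  \<open>j\<close>; every disjoint pair of edges is colored this way with the same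
  probability.\<close>

lemma sum_mono_edges_mult:
  assumes n: "n \<ge> 4" and G: "simple_graph {1..n} E"
    and ij: "i \<in> {1..s}" "j \<in> {1..s}" "i \<noteq> j"
  shows "(\<Sum>g\<in>colorings n s c. mono_edges E i g * mono_edges E j g) =
    card (colorings n s c) * (ffactorial (c i) 2 * ffactorial (c j) 2 *
      (2 / ffactorial n 4 * (real (card E choose 2) - real (pi3 E))))"
proof -
  have finE: "finite E" using simple_graph_finite[OF _ G] by simp
  have E2: "card e = 2" "e \<subseteq> {1..n}" if "e \<in> E" for e using G that by (auto simp: simple_graph_def)
  let ?D = "{(e, f). e \<in> E \<and> f \<in> E \<and> e \<inter> f = {}}"
  have finD: "finite ?D" by (rule finite_subset[of _ "E \<times> E"]) (use finE in auto)
  have N: "real (card (colorings_with n s c i j e f)) =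
      card (colorings n s c) * ffactorial (c i) 2 * ffactorial (c j) 2 / ffactorial n 4"
    if ef: "(e, f) \<in> ?D" for e f
  proof -
    have "card (colorings_with n s c i j e f) * ((n choose 2) * ((n - 2) choose 2)) =
        card (colorings n s c) * ((c i choose 2) * (c j choose 2))"
      using card_colorings_with[OF ij, of e n f c] ef E2 by auto
    then have "real (card (colorings_with n s c i j e f)) *
          (real (n choose 2) * real ((n - 2) choose 2)) =
        real (card (colorings n s c)) * (real (c i choose 2) * real (c j choose 2))"
      by (metis of_nat_mult)
    moreover have "real (n choose 2) \<noteq> 0" "real ((n - 2) choose 2) \<noteq> 0" using n by simp_all
    ultimately show ?thesis
      using n by (simp add: ffactorial_2 ffactorial_4 field_simps)
  qed
  have "mono_edges E i g * mono_edges E j g =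
      card {x \<in> ?D. (\<forall>v\<in>fst x. g v = i) \<and> (\<forall>v\<in>snd x. g v = j)}" for g
  proof -
    \<comment> \<open>A common vertex would carry both colors, so restricting to disjoint pairs
      loses nothing.\<close>
    have "{x \<in> ?D. (\<forall>v\<in>fst x. g v = i) \<and> (\<forall>v\<in>snd x. g v = j)} =
        {e \<in> E. \<forall>v\<in>e. g v = i} \<times> {e \<in> E. \<forall>v\<in>e. g v = j}"
      using ij(3) by fastforce
    then show ?thesis by (simp add: mono_edges_def card_cartesian_product)
  qed
  then have "(\<Sum>g\<in>colorings n s c. mono_edges E i g * mono_edges E j g) =
      real (\<Sum>g\<in>colorings n s c. card {x \<in> ?D. (\<forall>v\<in>fst x. g v = i) \<and> (\<forall>v\<in>snd x. g v = j)})"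
    by simp
  also have "(\<Sum>g\<in>colorings n s c. card {x \<in> ?D. (\<forall>v\<in>fst x. g v = i) \<and> (\<forall>v\<in>snd x. g v = j)}) =
      (\<Sum>x\<in>?D. card (colorings_with n s c i j (fst x) (snd x)))"
    using finD finite_colorings by (intro sum_multicount_gen) (auto simp: colorings_with_def)
  also have "real \<dots> = (\<Sum>x\<in>?D. real (card (colorings_with n s c i j (fst x) (snd x))))" by simp
  also have "\<dots> =
      (\<Sum>x\<in>?D. card (colorings n s c) * ffactorial (c i) 2 * ffactorial (c j) 2 / ffactorial n 4)"
    by (rule sum.cong) (use N in auto)
  also have "\<dots> = real (card ?D) *
      (card (colorings n s c) * ffactorial (c i) 2 * ffactorial (c j) 2 / ffactorial n 4)"
    by simp
  finally show ?thesis
    using card_disjoint_edge_pairs[OF _ G] by simp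
qed

lemma covariance_mono_edges:
  assumes n: "n \<ge> 4" and G: "simple_graph {1..n} E" and c: "(\<Sum>i=1..s. c i) = n"
    and ij: "i \<in> {1..s}" "j \<in> {1..s}" "i \<noteq> j"
  shows "covariance (random_coloring n s c) (mono_edges E i) (mono_edges E j) =
    ffactorial (c i) 2 * ffactorial (c j) 2 * gamma_coeff {1..n} E"
proof -
  let ?S = "colorings n s c"
  have S: "finite ?S" "?S \<noteq> {}" using finite_colorings colorings_nonempty[OF c] by auto
  then have N: "real (card ?S) \<noteq> 0" by simp
  have n2: "n \<ge> 2" using n by simp
  show ?thesis
    unfolding random_coloring_def covariance_pmf_of_set[OF S]
      sum_mono_edges[OF n2 G ij] sum_mono_edges[OF n2 G ij(2,1) ij(3)[symmetric]]
      sum_mono_edges_mult[OF n G ij]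
    \<comment> \<open>Both moments carry the number of colorings as a factor, which cancels and
      turns the sums into expectations.\<close>
    unfolding nonzero_mult_div_cancel_left[OF N]
    by (simp add: gamma_coeff_def power2_eq_square right_diff_distrib)
qed

text \<open>The last conjunct expresses dependence only on density and degrees as invariance of
  \<open>gamma_coeff\<close> among graphs on the same vertex set that agree in both.\<close>

theorem theorem1:
  fixes n m s :: nat and c :: "nat \<Rightarrow> nat" and E :: "nat set set"
  assumes "n \<ge> 4"
    and "simple_graph {1..n} E"
    and "card E = m"
    and "\<forall>i\<in>{1..s}. c i > 0"
    and "(\<Sum>i=1..s. c i) = n"
  shows "(\<forall>i\<in>{1..s}. \<forall>j\<in>{1..s}. i \<noteq> j \<longrightarrow>
            covariance (random_coloring n s c) (mono_edges E i) (mono_edges E j) =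
              ffactorial (c i) 2 * ffactorial (c j) 2 *
              (2 / ffactorial n 4 * (real (m choose 2) - real (pi3 E))
               - (real m / ffactorial n 2)\<^sup>2))
       \<and> (\<forall>i\<in>{1..s}. \<forall>j\<in>{1..s}. i \<noteq> j \<longrightarrow>
            covariance (random_coloring n s c) (mono_edges E i) (mono_edges E j) =
              gamma_coeff {1..n} E * ffactorial (c i) 2 * ffactorial (c j) 2)
       \<and> (\<forall>E'. simple_graph {1..n} E'
            \<and> graph_density {1..n} E' = graph_density {1..n} E
            \<and> degree_distribution {1..n} E' = degree_distribution {1..n} E
            \<longrightarrow> gamma_coeff {1..n} E' = gamma_coeff {1..n} E)"
  using covariance_mono_edges[OF assms(1,2,5)] gamma_coeff_cong[of "{1..n}" E] assms(1,2)
  by (auto simp: gamma_coeff_def assms(3) mult.commute)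

end
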